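(* Let $n$ be an even integer, let $\Sigma$ be an alphabet with exactly $n$ letters, and let $\Gamma$ be an alphabet. There exists a primitive word $w \in \Sigma^{2n}$ (that is, a primitive word over $\Sigma$ of length $2n$) such that $|w|_c = 2$ for all $c \in \Sigma$ and $$\max(\mathrm{Exp}_{\mathcal I(\Sigma,\Gamma)}(w)) \geq \frac{|w|}{2} - 1.$$
   Context: Alphabets are finite and have at least two letters. $\Sigma^*$ (resp. $\Sigma^+$) is the set of all (resp. all nonempty) words over $\Sigma$; $|w|$ is the length of $w$ and $|w|_c$ is the number of occurrences of the letter $c$ in $w$; $\mathbb Z_+$ is the set of positive integers. A nonempty word is primitive if it is not a power of a shorter word. A morphism $h:\Sigma^*\to\Gamma^*$ is a map with $h(xy)=h(x)h(y)$ for all words $x,y$. $\mathcal I(\Sigma,\Gamma)$ is the family of all injective morphisms $\Sigma^*\to\Gamma^*$. For a family $H$ of morphisms $\Sigma^*\to\Gamma^*$ and $w\in\Sigma^+$, define $\mathrm{Exp}_H(w)=\{n\in\mathbb Z_+ \mid \exists h\in H,\ r\in\Gamma^+ : h(w)=r^n \text{ and } r \text{ is primitive}\}$. *)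

theory Defs
  imports Complex_Main "HOL-Library.Cardinality"
begin

text \<open>An alphabet is a finite type with at least two elements; words over it are lists.\<close>

definition word_pow :: "'a list \<Rightarrow> nat \<Rightarrow> 'a list" where
  "word_pow u k = concat (replicate k u)"

definition primitive :: "'a list \<Rightarrow> bool" where
  "primitive w \<longleftrightarrow> w \<noteq> [] \<and> \<not> (\<exists>u k. length u < length w \<and> w = word_pow u k)"

definition morphism :: "('a list \<Rightarrow> 'b list) \<Rightarrow> bool" where
  "morphism h \<longleftrightarrow> (\<forall>x y. h (x @ y) = h x @ h y)"

definition injective_morphisms :: "('a list \<Rightarrow> 'b list) set" where
  "injective_morphisms = {h. morphism h \<and> inj h}"

definition Exp :: "('a list \<Rightarrow> 'b list) set \<Rightarrow> 'a list \<Rightarrow> nat set" where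
  "Exp H w = {n. n > 0 \<and> (\<exists>h\<in>H. \<exists>r. h w = word_pow r n \<and> primitive r)}"

end

theory Submission
  imports Defs
begin

text \<open>
  Write \<open>N = n - 1 = 2 m + 1\<close> and name the letters \<open>0, \<dots>, N\<close>. The prefix code
  \<open>i \<mapsto> a\<^sup>i b a\<^bsup>N-1-i\<^esup>\<close> (for \<open>i < N\<close>), \<open>N \<mapsto> a\<^sup>N\<close> maps the word
  \<open>00 22 44 \<dots> (N-1)(N-1) N 11 33 \<dots> (N-2)(N-2) N\<close> to the \<open>N\<close>-th power of the primitive word
  \<open>b a\<^bsup>N-1\<^esup> b a\<^bsup>N+1\<^esup>\<close>: consecutive exponents of \<open>a\<close> alternate between \<open>N - 1\<close> and
  \<open>N + 1\<close>, and the two occurrences of \<open>N\<close> compensate the two places where adding 2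
  wraps around modulo \<open>N\<close>. Conversely, an exponent cannot exceed \<open>|w|\<close>, because the image of every
  letter must be shorter than the primitive root of \<open>h w\<close>.
\<close>

section \<open>Powers of words, their rotations, and a primitivity test\<close>

lemma word_pow_Suc: "word_pow u (Suc k) = u @ word_pow u k"
  by (simp add: word_pow_def)

lemma length_word_pow: "length (word_pow u k) = k * length u"
  by (simp add: word_pow_def length_concat sum_list_replicate)

lemma count_list_word_pow: "count_list (word_pow u k) c = k * count_list u c"
  by (induction k) (simp_all add: word_pow_def)

lemma word_pow_add: "word_pow u (j + k) = word_pow u j @ word_pow u k"
  by (simp add: word_pow_def replicate_add)

lemma word_pow_Suc_right: "word_pow u (Suc k) = word_pow u k @ u"
  using word_pow_add[of u k 1] by (simp add: word_pow_def)

text \<open>Lets an occurrence of a letter be moved to the front of \<open>h w\<close> while keeping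
  a \<open>k\<close>-th power. One-letter rotations suffice, and for these the first letter of the
  root slides through all factors.\<close>

lemma rotate_word_pow: "rotate d (word_pow u k) = word_pow (rotate d u) k"
proof (induction d)
  case (Suc d)
  have "rotate1 (word_pow v k) = word_pow (rotate1 v) k" for v :: "'a list"
  proof (cases v)
    case Nil
    then show ?thesis by (simp add: word_pow_def)
  next
    case (Cons x y)
    have *: "x # word_pow (y @ [x]) j = word_pow (x # y) j @ [x]" for j
      by (induction j) (simp_all add: word_pow_def)
    show ?thesis
      by (cases k) (simp_all add: Cons word_pow_Suc * word_pow_def[of _ 0])
  qed
  with Suc show ?case by simp
qed simp

text \<open>Counting \<open>c\<close> forces the exponent of a proper power to divide 2, leaving
  only a square \<open>u @ u\<close>, whose first half would contain just one of the two occurrences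
  of \<open>c\<close>.\<close>

lemma primitiveI_count:
  assumes "count_list w c = 2" "2 \<le> count_list (take (length w div 2) w) c"
  shows "primitive w"
proof -
  have False if "length u < length w" "w = word_pow u k" for u k
  proof -
    have "k * count_list u c = 2"
      using assms(1) that(2) count_list_word_pow by metis
    then have "k dvd 2" by (metis dvd_triv_left)
    then have "k = 1 \<or> k = 2" using dvd_imp_le[of k 2] by (cases k) auto
    moreover have "k \<noteq> 1" using that by (auto simp: word_pow_def)
    ultimately have "k = 2" by simp
    then have w: "w = u @ u" using that(2) by (simp add: word_pow_def numeral_2_eq_2)
    with assms show False by simp
  qed
  moreover have "w \<noteq> []" using assms(1) by auto
  ultimately show ?thesis unfolding primitive_def by blast
qed

section \<open>Bounding the exponents\<close>

lemma morphism_Nil: "morphism h \<Longrightarrow> h [] = []"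
  unfolding morphism_def by (metis append_Nil append_self_conv)

lemma length_morphism_le:
  assumes "morphism h" "\<And>c. length (h [c]) \<le> m"
  shows "length (h w) \<le> length w * m"
proof (induction w)
  case Nil
  then show ?case using morphism_Nil[OF assms(1)] by simp
next
  case (Cons c w)
  have "h (c # w) = h [c] @ h w"
    using assms(1) unfolding morphism_def by (metis append_Cons append_Nil)
  then show ?case using Cons assms(2)[of c] by simp
qed

text \<open>If the image of a letter \<open>x\<close> were at least as long as \<open>r\<close>, its two occurrences would have
  to lie at congruent positions modulo the period, so both return words of \<open>x\<close> in the conjugacy
  class of \<open>w\<close> would have commuting images and hence coincide.\<close>

lemma length_image_less_root:
  assumes h: "h \<in> injective_morphisms" and w: "primitive w" "count_list w x = 2"
    and r: "h w = word_pow r k" "k > 0"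
  shows "length (h [x]) < length r"
proof (rule ccontr)
  assume "\<not> length (h [x]) < length r"
  then have long: "length r \<le> length (h [x])" by simp
  have app: "h (u @ v) = h u @ h v" for u v
    using h by (auto simp: injective_morphisms_def morphism_def)
  have "inj h" using h by (simp add: injective_morphisms_def)
  have "x \<in> set w" using w(2) by (metis count_notin zero_neq_numeral)
  then obtain p u where pu: "w = p @ x # u" "x \<notin> set p" by (meson split_list_first)
  then have c: "count_list u x = 1" using w(2) by simp
  then have "x \<in> set u" by (metis count_notin zero_neq_one)
  then obtain q s where qs: "u = q @ x # s" "x \<notin> set q" by (meson split_list_first)
  then have s: "x \<notin> set s" using c by (simp add: count_list_0_iff)
  have wx: "w = p @ [x] @ q @ [x] @ s" using pu qs by simp
  define P where "P = length (h p)"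
  define D where "D = length (h [x] @ h q)"
  \<comment> \<open>Rotating by \<open>P\<close> brings the first occurrence of \<open>x\<close> to
    the front; the further rotation by \<open>D\<close> brings the second.\<close>
  have "rotate P (h w) = h [x] @ h q @ h [x] @ h s @ h p"
    unfolding wx app P_def by (simp add: rotate_append)
  then have 1: "word_pow (rotate P r) k = h [x] @ h q @ h [x] @ h s @ h p"
    using r by (simp add: rotate_word_pow)
  have "rotate D ((h [x] @ h q) @ h [x] @ h s @ h p) = (h [x] @ h s @ h p) @ h [x] @ h q"
    unfolding D_def by (rule rotate_append[THEN trans]) simp
  then have 2: "word_pow (rotate D (rotate P r)) k = h [x] @ h s @ h p @ h [x] @ h q"
    using 1 by (metis rotate_word_pow append.assoc)
  obtain k' where k: "k = Suc k'" using r(2) gr0_implies_Suc by blast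
  \<comment> \<open>Both rotated roots are the same prefix of \<open>h [x]\<close>, so the powers in
    \<open>1\<close> and \<open>2\<close> coincide.\<close>
  have "rotate P r = take (length r) (h [x])"
    using arg_cong[OF 1, of "take (length r)"] long by (simp add: k word_pow_Suc)
  moreover have "rotate D (rotate P r) = take (length r) (h [x])"
    using arg_cong[OF 2, of "take (length r)"] long by (simp add: k word_pow_Suc)
  ultimately have "h ([x] @ q @ [x] @ s @ p) = h ([x] @ s @ p @ [x] @ q)"
    using 1 2 unfolding app by simp
  then have "q @ x # (s @ p) = (s @ p) @ x # q"
    using \<open>inj h\<close> by (simp add: inj_eq)
  \<comment> \<open>Neither \<open>q\<close> nor \<open>s @ p\<close> contains \<open>x\<close>, so
    the first occurrence of \<open>x\<close> is the displayed one on both sides.\<close>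
  then have "q = s @ p"
    using append_Cons_eq_iff[THEN iffD1, of x q "s @ p" "s @ p" q] qs(2) s pu(2)
    by (metis Un_iff set_append)
  then have "w = word_pow (p @ [x] @ s) 2"
    by (simp add: wx word_pow_def numeral_2_eq_2)
  moreover have "length (p @ [x] @ s) < length w" by (simp add: wx)
  ultimately show False using w(1) unfolding primitive_def by blast
qed

text \<open>Makes \<open>Max\<close> meaningful. As every letter image is shorter than
  \<open>r\<close>, comparing the length \<open>k * length r\<close> of \<open>h w\<close> with
  \<open>length w * length r\<close> bounds \<open>k\<close>.\<close>

lemma finite_Exp_count_2:
  assumes "primitive w" "\<And>c. count_list w c = 2"
  shows "finite (Exp (injective_morphisms :: ('a list \<Rightarrow> 'b list) set) w)" (is "finite ?E")
proof (rule finite_subset)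
  show "?E \<subseteq> {..length w}"
  proof
    fix k assume "k \<in> ?E"
    then obtain h :: "'a list \<Rightarrow> 'b list" and r where hr: "h \<in> injective_morphisms" "h w = word_pow r k" "primitive r" "k > 0"
      unfolding Exp_def by blast
    have "length (h w) \<le> length w * length r"
      using length_image_less_root[OF hr(1) assms hr(2,4)] hr(1)
      by (intro length_morphism_le) (auto simp: injective_morphisms_def less_imp_le)
    moreover have "length r > 0" using hr(3) by (simp add: primitive_def)
    ultimately show "k \<in> {..length w}" using hr(2) by (simp add: length_word_pow)
  qed
qed simp

section \<open>Injectivity from prefix codes\<close>

lemma concat_map_prefix_code_inj:
  assumes "\<And>c. g c \<noteq> []" "\<And>c d u v. g c @ u = g d @ v \<Longrightarrow> c = d"
  shows "inj (\<lambda>x. concat (map g x))"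
proof (rule injI)
  fix x y assume "concat (map g x) = concat (map g y)"
  then show "x = y"
  proof (induction x arbitrary: y)
    case Nil
    then show ?case using assms(1) by (cases y) auto
  next
    case (Cons c x)
    show ?case
    proof (cases y)
      case Nil
      then show ?thesis using Cons.prems assms(1) by simp
    next
      case (Cons d z)
      then have "g c @ concat (map g x) = g d @ concat (map g z)" using Cons.prems by simp
      moreover from this have "c = d" by (rule assms(2))
      ultimately show ?thesis using Cons Cons.IH by simp
    qed
  qed
qed

section \<open>The word, with natural numbers as letters\<close>

definition doubles :: "nat \<Rightarrow> nat \<Rightarrow> nat list" where
  "doubles e k = concat (map (\<lambda>i. [2 * i + e, 2 * i + e]) [0..<k])"

lemma doubles_simps:
  "doubles e 0 = []" "doubles e (Suc k) = doubles e k @ [2 * k + e, 2 * k + e]"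
  by (simp_all add: doubles_def)

lemma length_doubles: "length (doubles e k) = 2 * k"
  by (induction k) (simp_all add: doubles_simps)

lemma set_doubles: "set (doubles e k) = (\<lambda>i. 2 * i + e) ` {..<k}"
  by (induction k) (auto simp: doubles_simps lessThan_Suc)

lemma count_list_doubles:
  "count_list (doubles e k) c = (if c \<in> (\<lambda>i. 2 * i + e) ` {..<k} then 2 else 0)"
  by (induction k) (auto simp: doubles_simps lessThan_Suc)

definition pattern :: "nat \<Rightarrow> nat list" where
  "pattern m = doubles 0 (Suc m) @ [2 * m + 1] @ doubles 1 m @ [2 * m + 1]"

lemma length_pattern: "length (pattern m) = 4 * m + 4"
  by (simp add: pattern_def length_doubles)

lemma count_list_pattern:
  assumes "c < 2 * m + 2"
  shows "count_list (pattern m) c = 2"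
proof (cases "even c")
  case True
  then obtain i where "c = 2 * i" by blast
  moreover have "2 * i \<noteq> Suc (2 * j)" "Suc (2 * j) \<noteq> 2 * i" for j by presburger+
  ultimately show ?thesis
    using assms by (auto simp: pattern_def count_list_doubles image_iff)
next
  case False
  then obtain i where "c = 2 * i + 1" using oddE by blast
  moreover have "Suc (2 * i) \<noteq> 2 * j" for j by presburger
  ultimately show ?thesis
    using assms by (auto simp: pattern_def count_list_doubles image_iff)
qed

lemma set_pattern: "set (pattern m) = {..<2 * m + 2}"
proof
  show "set (pattern m) \<subseteq> {..<2 * m + 2}"
    by (auto simp: pattern_def set_doubles)
  show "{..<2 * m + 2} \<subseteq> set (pattern m)"
    using count_list_pattern count_notin by (metis lessThan_iff subsetI zero_neq_numeral)
qed

text \<open>Puts both occurrences of 0 into the first half, as \<open>primitiveI_count\<close>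
  requires.\<close>

lemma pattern_starts_square: "\<exists>u. pattern m = 0 # 0 # u"
proof -
  have "\<exists>u. doubles 0 (Suc m) = 0 # 0 # u"
    unfolding doubles_def by (simp add: upt_conv_Cons del: upt_Suc)
  then show ?thesis by (auto simp: pattern_def)
qed

section \<open>The code and the image of the word\<close>

definition code_word :: "'b \<Rightarrow> 'b \<Rightarrow> nat \<Rightarrow> nat \<Rightarrow> 'b list" where
  "code_word a b m i = (if i = 2 * m + 1 then replicate i a
    else replicate i a @ [b] @ replicate (2 * m - i) a)"

text \<open>For \<open>i < j\<close>, position \<open>i\<close> separates the two words: it holds
  \<open>b\<close> in the first and \<open>a\<close> in the second.\<close>

lemma code_prefix_free:
  assumes "a \<noteq> b" "i < 2 * m + 2" "j < 2 * m + 2" "code_word a b m i @ u = code_word a b m j @ v"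
  shows "i = j"
proof -
  have *: False if "i < j" "j < 2 * m + 2" "code_word a b m i @ u = code_word a b m j @ v" for i j u v
  proof -
    have "(code_word a b m i @ u) ! i = b" using that(1,2) by (simp add: code_word_def nth_append)
    moreover have "(code_word a b m j @ v) ! i = a"
      using that(1) by (simp add: code_word_def nth_append del: replicate_Suc)
    ultimately show False using that assms(1) by simp
  qed
  show ?thesis using *[of i j u v] *[of j i v u] assms by (metis linorder_neqE_nat)
qed

definition period_word :: "'b \<Rightarrow> 'b \<Rightarrow> nat \<Rightarrow> 'b list" where
  "period_word a b m = [b] @ replicate (2 * m) a @ [b] @ replicate (2 * m + 2) a"

text \<open>Half of the length is \<open>2 * m + 2\<close>, so the first half ends exactly at the
  second \<open>b\<close>.\<close>

lemma primitive_period_word: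
  assumes "a \<noteq> b"
  shows "primitive (period_word a b m)"
proof (rule primitiveI_count)
  have r: "count_list (replicate j a) b = 0" for j using assms by (induction j) auto
  show "count_list (period_word a b m) b = 2" by (simp add: period_word_def r del: replicate_Suc)
  have l: "length (period_word a b m) div 2 = length ([b] @ replicate (2 * m) a @ [b])"
    by (simp add: period_word_def)
  have "period_word a b m = ([b] @ replicate (2 * m) a @ [b]) @ replicate (2 * m + 2) a"
    by (simp add: period_word_def)
  then have "take (length (period_word a b m) div 2) (period_word a b m) = [b] @ replicate (2 * m) a @ [b]"
    using l by (metis append_eq_conv_conj)
  then show "2 \<le> count_list (take (length (period_word a b m) div 2) (period_word a b m)) b" by simp
qed

text \<open>The appended block of \<open>a\<close> completes the last period. In the induction, the
  completion for the earlier pairs supplies the leading \<open>a\<close>-block of the next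
  pair.\<close>

lemma concat_code_word_doubles:
  assumes "2 * k + e \<le> 2 * m + 2"
  shows "concat (map (code_word a b m) (doubles e k)) @ replicate (2 * k + e) a
    = replicate e a @ word_pow (period_word a b m) k"
  using assms
proof (induction k)
  case 0
  then show ?case by (simp add: doubles_simps word_pow_def)
next
  case (Suc k)
  define i where "i = 2 * k + e"
  have i: "i \<le> 2 * m" using Suc.prems by (simp add: i_def)
  \<comment> \<open>Used with \<open>j = 0\<close> for the gap between the two copies of
    \<open>i\<close>, and with \<open>j = 2\<close> for the gap after them.\<close>
  have r: "replicate (2 * m - i) a @ replicate (i + j) a = replicate (2 * m + j) a" for j
    unfolding replicate_add[symmetric] using i by simp
  have "code_word a b m i @ code_word a b m i @ replicate (i + 2) a = replicate i a @ [b] @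
      (replicate (2 * m - i) a @ replicate i a) @ [b] @ (replicate (2 * m - i) a @ replicate (i + 2) a)"
    using i by (simp add: code_word_def)
  also have "\<dots> = replicate i a @ period_word a b m"
    unfolding r r[of 0, simplified] by (simp add: period_word_def)
  finally have "concat (map (code_word a b m) (doubles e (Suc k))) @ replicate (2 * Suc k + e) a
      = (concat (map (code_word a b m) (doubles e k)) @ replicate (2 * k + e) a) @ period_word a b m"
    by (simp add: doubles_simps i_def)
  then show ?case using Suc by (simp add: word_pow_Suc_right)
qed

lemma concat_code_word_pattern:
  "concat (map (code_word a b m) (pattern m)) = word_pow (period_word a b m) (2 * m + 1)"
proof -
  let ?C = "\<lambda>x. concat (map (code_word a b m) x)"
  have "?C (pattern m) = ?C (doubles 0 (Suc m)) @ replicate (2 * m + 1) a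
      @ (?C (doubles 1 m) @ replicate (2 * m + 1) a)"
    by (simp add: pattern_def code_word_def)
  \<comment> \<open>The last letter completes the odd block exactly. The \<open>a\<close> left at
    its front joins the image of the first \<open>2 * m + 1\<close> to give the
    \<open>2 * m + 2\<close> letters that complete the even block.\<close>
  also have "?C (doubles 1 m) @ replicate (2 * m + 1) a = [a] @ word_pow (period_word a b m) m"
    using concat_code_word_doubles[of m 1 m a b] by simp
  also have "?C (doubles 0 (Suc m)) @ replicate (2 * m + 1) a @ [a] @ word_pow (period_word a b m) m
      = (?C (doubles 0 (Suc m)) @ replicate (2 * Suc m + 0) a) @ word_pow (period_word a b m) m"
    by (simp add: replicate_app_Cons_same)
  also have "\<dots> = word_pow (period_word a b m) (Suc m) @ word_pow (period_word a b m) m"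
    by (subst concat_code_word_doubles) simp_all
  also have "\<dots> = word_pow (period_word a b m) (2 * m + 1)"
    by (simp flip: word_pow_add add: mult_2)
  finally show ?thesis .
qed

section \<open>Transfer to the given alphabets\<close>

theorem theorem4p3:
  fixes n :: nat
  assumes "even n"
    and "CARD('a::finite) = n" and "CARD('a) \<ge> 2"
    and "CARD('b::finite) \<ge> 2"
  shows "\<exists>w :: 'a list. primitive w \<and> length w = 2 * n \<and>
    (\<forall>c. count_list w c = 2) \<and>
    (let E = Exp (injective_morphisms :: ('a list \<Rightarrow> 'b list) set) w in
       finite E \<and> E \<noteq> {} \<and> real (Max E) \<ge> real (length w) / 2 - 1)"
proof -
  obtain l where "n = 2 * l" using assms(1) by blast
  moreover have "n \<ge> 2" using assms by simp
  ultimately obtain m where n: "n = 2 * m + 2" by (cases l) auto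
  obtain a b :: 'b where ab: "a \<noteq> b"
    using assms(4) card_le_Suc0_iff_eq[of "UNIV :: 'b set"] by auto
  obtain f :: "nat \<Rightarrow> 'a" where f: "bij_betw f {..<n} UNIV"
    using ex_bij_betw_nat_finite[of "UNIV :: 'a set"] assms(2)
    by (auto simp: atLeast0LessThan)
  define f' where "f' = inv_into {..<n} f"
  have f': "f' c < n" "f (f' c) = c" for c
    using f inv_into_into[of c f "{..<n}"] f_inv_into_f[of c f "{..<n}"]
    by (auto simp: f'_def bij_betw_def)
  have f'f: "f' (f i) = i" if "i < n" for i
    using that bij_betw_inv_into_left[OF f] by (simp add: f'_def)
  define w where "w = map f (pattern m)"
  have len: "length w = 2 * n" by (simp add: w_def length_pattern n)
  have count: "count_list w c = 2" for c
  proof -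
    have "count_list w (f (f' c)) = count_list (pattern m) (f' c)"
      unfolding w_def using f f'(1)[of c]
      by (intro count_list_inj_map) (simp_all add: set_pattern n bij_betw_def)
    then show ?thesis using f' count_list_pattern n by metis
  qed
  have prim: "primitive w"
  proof (rule primitiveI_count)
    show "count_list w (f 0) = 2" by (rule count)
    obtain u where "w = f 0 # f 0 # u" using pattern_starts_square[of m] by (auto simp: w_def)
    then show "2 \<le> count_list (take (length w div 2) w) (f 0)"
      unfolding len by (simp add: n)
  qed
  define h where "h x = concat (map (\<lambda>c. code_word a b m (f' c)) x)" for x
  have "inj h"
    unfolding h_def
  proof (rule concat_map_prefix_code_inj)
    show "code_word a b m (f' c) \<noteq> []" for c by (simp add: code_word_def)
    show "c = d" if "code_word a b m (f' c) @ u = code_word a b m (f' d) @ v" for c d u v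
      using code_prefix_free[OF ab _ _ that] f' n by metis
  qed
  then have h: "h \<in> injective_morphisms" by (simp add: injective_morphisms_def morphism_def h_def)
  have "map (\<lambda>c. code_word a b m (f' c)) w = map (code_word a b m) (pattern m)"
    using f'f by (simp add: w_def set_pattern n)
  then have "h w = word_pow (period_word a b m) (n - 1)"
    using concat_code_word_pattern[of a b m] by (simp add: h_def n)
  then have "n - 1 \<in> Exp (injective_morphisms :: ('a list \<Rightarrow> 'b list) set) w"
    using h primitive_period_word[OF ab] n by (auto simp: Exp_def)
  moreover have fin: "finite (Exp (injective_morphisms :: ('a list \<Rightarrow> 'b list) set) w)"
    using finite_Exp_count_2[OF prim count] .
  ultimately have "n - 1 \<le> Max (Exp (injective_morphisms :: ('a list \<Rightarrow> 'b list) set) w)"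
    and "Exp (injective_morphisms :: ('a list \<Rightarrow> 'b list) set) w \<noteq> {}"
    by auto
  moreover have "real (length w) / 2 - 1 = real (n - 1)"
    using len n by simp
  ultimately show ?thesis
    using prim len count fin unfolding Let_def by (metis of_nat_mono)
qed

end
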